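(* Assume $1<p_i<+\infty$ for $i=1,\dots,m$. Let $a=(a_1,\dots,a_d)^T$, $b=(b_1,\dots,b_d)^T$ and $c=(c_1,\dots,c_d)^T$ be consecutive breaking points of a geodesic path such that $a\in P_i\setminus F_{ij}$, $b\in F_{ij}$ and $c\in P_j\setminus F_{ij}$ (where $i,j$ are the consecutive cells of the path whose gate point in $F_{ij}$ is $b$). Let $\mathcal{F}_b$ be the face of $F_{ij}$ such that $b$ lies in the relative interior of $\mathcal{F}_b$. Then the gate point $b$ satisfies $$\omega_i\sum_{k=1}^d\left[\frac{|b_k-a_k|}{\|b-a\|_{p_i}}\right]^{p_i-1}\mathrm{sign}(b_k-a_k)(f_k-g_k)=\omega_j\sum_{k=1}^d\left[\frac{|c_k-b_k|}{\|c-b\|_{p_j}}\right]^{p_j-1}\mathrm{sign}(c_k-b_k)(f_k-g_k)$$ for all points $f=(f_1,\dots,f_d)^T,\ g=(g_1,\dots,g_d)^T\in\mathcal{F}_b$.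
   Context: Setting. $P_1,\dots,P_m\subseteq\mathbb{R}^d$ are the cells of a polyhedral subdivision, with $\mathrm{int}(P_i)\cap\mathrm{int}(P_j)=\emptyset$ for $i\ne j$; the cells are assumed to be polytopes (bounded polyhedra). Cell $P_i$ is endowed with the $\ell_{p_i}$-norm $\|\cdot\|_{p_i}$ and a weight $\omega_i>0$. The undirected graph $G=(V,E)$ has $V=\{1,\dots,m\}$ and $\{i,j\}\in E$ ($i\neq j$) iff $P_i$ and $P_j$ have a common (nonempty) face; for $\{i,j\}\in E$, $F_{ij}=F_{ji}=P_i\cap P_j$ is their maximal common face. Points $x_s\in P_s$, $x_t\in P_t$, $s\ne t$, are given, and $\Gamma$ is the set of simple paths $(s,i_1,\dots,i_k,t)$ from $s$ to $t$ in $G$ (all vertices distinct). Geodesic path. Fix $\gamma=(i_0,i_1,\dots,i_k,i_{k+1})\in\Gamma$ with $i_0=s$, $i_{k+1}=t$. Let the gate points $y_{i_r i_{r+1}}\in F_{i_r i_{r+1}}$, $r=0,\dots,k$, minimize, over $F_{i_0i_1}\times\dots\times F_{i_ki_{k+1}}$, $$\omega_s\|y_{s i_1}-x_s\|_{p_s}+\sum_{r=1}^{k}\omega_{i_r}\|y_{i_r i_{r+1}}-y_{i_{r-1}i_r}\|_{p_{i_r}}+\omega_t\|x_t-y_{i_k t}\|_{p_t}.$$ The piecewise linear path through $x_s,y_{si_1},y_{i_1i_2},\dots,y_{i_kt},x_t$ (in this order) is called a geodesic path between $x_s$ and $x_t$, and these points are its breaking points. *)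

theory Defs
  imports "HOL-Analysis.Analysis"
begin

definition lp_norm :: "real \<Rightarrow> real ^ 'd \<Rightarrow> real" where
  "lp_norm p x = (\<Sum>k\<in>UNIV. \<bar>x $ k\<bar> powr p) powr (1 / p)"

text \<open>
  The cells \<open>P 1, \<dots>, P m\<close> meet face-to-face; the common face may be empty, since
  \<open>{} face_of S\<close> holds in the library.
\<close>

definition polyhedral_subdivision :: "nat \<Rightarrow> (nat \<Rightarrow> (real ^ 'd) set) \<Rightarrow> bool" where
  "polyhedral_subdivision m P \<longleftrightarrow>
     (\<forall>i\<in>{1..m}. polytope (P i)) \<and>
     (\<forall>i\<in>{1..m}. \<forall>j\<in>{1..m}. i \<noteq> j \<longrightarrow>
        interior (P i) \<inter> interior (P j) = {} \<and>
        (P i \<inter> P j) face_of P i \<and> (P i \<inter> P j) face_of P j)"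

definition common_face :: "(nat \<Rightarrow> (real ^ 'd) set) \<Rightarrow> nat \<Rightarrow> nat \<Rightarrow> (real ^ 'd) set" where
  "common_face P i j = P i \<inter> P j"

definition cell_edges :: "nat \<Rightarrow> (nat \<Rightarrow> (real ^ 'd) set) \<Rightarrow> nat set set" where
  "cell_edges m P =
     {{i, j} |i j. i \<in> {1..m} \<and> j \<in> {1..m} \<and> i \<noteq> j \<and>
        (\<exists>F. F \<noteq> {} \<and> F face_of P i \<and> F face_of P j)}"

definition simple_paths ::
  "nat \<Rightarrow> (nat \<Rightarrow> (real ^ 'd) set) \<Rightarrow> nat \<Rightarrow> nat \<Rightarrow> nat list set" where
  "simple_paths m P s t =
     {\<gamma>. \<gamma> \<noteq> [] \<and> hd \<gamma> = s \<and> last \<gamma> = t \<and> set \<gamma> \<subseteq> {1..m} \<and> distinct \<gamma> \<and>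
         successively (\<lambda>i j. {i, j} \<in> cell_edges m P) \<gamma>}"

text \<open>
  For \<open>\<gamma> = [i\<^sub>0, \<dots>, i\<^sub>k\<^sub>+\<^sub>1]\<close>, the entry \<open>ys ! r\<close> is the gate point between the cells
  \<open>i\<^sub>r\<close> and \<open>i\<^sub>r\<^sub>+\<^sub>1\<close>.
\<close>

definition gate_points :: "(nat \<Rightarrow> (real ^ 'd) set) \<Rightarrow> nat list \<Rightarrow> (real ^ 'd) list set" where
  "gate_points P \<gamma> =
     {ys. length ys = length \<gamma> - 1 \<and>
          (\<forall>r < length ys. ys ! r \<in> common_face P (\<gamma> ! r) (\<gamma> ! Suc r))}"

definition breaking_points :: "real ^ 'd \<Rightarrow> real ^ 'd \<Rightarrow> (real ^ 'd) list \<Rightarrow> (real ^ 'd) list" where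
  "breaking_points x\<^sub>s x\<^sub>t ys = x\<^sub>s # ys @ [x\<^sub>t]"

text \<open>
  The segment from \<open>z ! r\<close> to \<open>z ! Suc r\<close> is travelled in the cell \<open>\<gamma> ! r\<close>; a path \<open>\<gamma>\<close> of
  \<open>n\<close> cells has \<open>n + 1\<close> breaking points \<open>z\<close>.
\<close>

definition weighted_length ::
  "(nat \<Rightarrow> real) \<Rightarrow> (nat \<Rightarrow> real) \<Rightarrow> nat list \<Rightarrow> (real ^ 'd) list \<Rightarrow> real" where
  "weighted_length p \<omega> \<gamma> z =
     (\<Sum>r<length \<gamma>. \<omega> (\<gamma> ! r) * lp_norm (p (\<gamma> ! r)) (z ! Suc r - z ! r))"

text \<open>
  A geodesic path is represented by its list \<open>z\<close> of breaking points. The minimization is over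
  the gate points of the given \<open>\<gamma>\<close> only, not over all paths from \<open>s\<close> to \<open>t\<close>.
\<close>

definition geodesic_path ::
  "nat \<Rightarrow> (nat \<Rightarrow> (real ^ 'd) set) \<Rightarrow> (nat \<Rightarrow> real) \<Rightarrow> (nat \<Rightarrow> real) \<Rightarrow> nat \<Rightarrow> nat \<Rightarrow>
   real ^ 'd \<Rightarrow> real ^ 'd \<Rightarrow> nat list \<Rightarrow> (real ^ 'd) list \<Rightarrow> bool" where
  "geodesic_path m P p \<omega> s t x\<^sub>s x\<^sub>t \<gamma> z \<longleftrightarrow>
     \<gamma> \<in> simple_paths m P s t \<and>
     (\<exists>ys. is_arg_min (\<lambda>ys. weighted_length p \<omega> \<gamma> (breaking_points x\<^sub>s x\<^sub>t ys))
             (\<lambda>ys. ys \<in> gate_points P \<gamma>) ys \<and>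
           z = breaking_points x\<^sub>s x\<^sub>t ys)"

end

theory Submission
  imports Defs
begin

text \<open>
  Moving the gate point \<open>b\<close> along \<open>f - g\<close> keeps it in the face \<open>F\<^sub>b\<close> for small displacements of
  either sign, because \<open>b\<close> is a relative interior point. The length of the path, of which only
  two summands change, therefore has a local minimum at \<open>b\<close>; since \<open>a \<noteq> b \<noteq> c\<close> and all exponents
  exceed \<open>1\<close>, it is differentiable there, and the claim is that its derivative vanishes.
\<close>

text \<open>Away from \<open>0\<close> this is the chain rule. At \<open>0\<close> the difference
  quotient has absolute value \<open>\<bar>h\<bar> powr (p - 1)\<close>, which tends to
  \<open>0\<close> because \<open>p > 1\<close>; the formula agrees, since
  \<open>sgn 0 = 0\<close>.\<close>

lemma has_real_derivative_abs_powr: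
  fixes p x :: real
  assumes "1 < p"
  shows "((\<lambda>x. \<bar>x\<bar> powr p) has_real_derivative p * \<bar>x\<bar> powr (p - 1) * sgn x) (at x)"
proof (cases "x = 0")
  case False
  have "(abs has_real_derivative sgn x) (at x)"
    using has_derivative_norm[OF False]
    unfolding has_field_derivative_def real_norm_def[abs_def] inner_real_def mult_commute_abs .
  from DERIV_fun_powr[OF this, of p] show ?thesis
    using False by simp
next
  case True
  have "((\<lambda>h::real. \<bar>h\<bar> powr (p - 1)) \<longlongrightarrow> 0) (at 0)"
    by (rule tendsto_zero_powrI[OF tendsto_rabs_zero[OF tendsto_ident_at] tendsto_const])
       (use assms in auto)
  moreover have "norm (\<bar>h\<bar> powr p / h) \<le> \<bar>h\<bar> powr (p - 1)" for h :: real
    by (cases "h = 0") (simp_all add: powr_diff)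
  ultimately have "((\<lambda>h. \<bar>h\<bar> powr p / h) \<longlongrightarrow> 0) (at 0)"
    by (metis (no_types, lifting) Lim_null_comparison always_eventually)
  then show ?thesis
    using True by (simp add: has_field_derivative_iff)
qed

lemma sum_abs_powr_pos:
  fixes x :: "real ^ 'd"
  assumes "x \<noteq> 0"
  shows "0 < (\<Sum>k\<in>UNIV. \<bar>x $ k\<bar> powr p)"
proof -
  obtain k where "x $ k \<noteq> 0"
    using assms by (auto simp: vec_eq_iff)
  then show ?thesis
    by (intro sum_pos2[of _ k]) auto
qed

text \<open>Chain rule for the power \<open>1 / p\<close> of the sum \<open>S\<close> of
  \<open>p\<close>-th powers. As \<open>x \<noteq> 0\<close>, \<open>S\<close> is positive at
  \<open>0\<close>, where the outer power is therefore differentiable.\<close>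

lemma lp_norm_has_real_derivative_line:
  fixes x v :: "real ^ 'd"
  assumes "1 < p" and "x \<noteq> 0"
  shows "((\<lambda>h. lp_norm p (x + h *\<^sub>R v)) has_real_derivative
           (\<Sum>k\<in>UNIV. (\<bar>x $ k\<bar> / lp_norm p x) powr (p - 1) * sgn (x $ k) * v $ k)) (at 0)"
proof -
  define S where "S = (\<lambda>h. \<Sum>k\<in>UNIV. \<bar>x $ k + h * v $ k\<bar> powr p)"
  define D where "D = (\<Sum>k\<in>UNIV. \<bar>x $ k\<bar> powr (p - 1) * sgn (x $ k) * v $ k)"
  have S0: "0 < S 0"
    using sum_abs_powr_pos[OF assms(2)] by (simp add: S_def)
  have "((\<lambda>h. \<bar>x $ k + h * v $ k\<bar> powr p) has_real_derivative
          p * \<bar>x $ k\<bar> powr (p - 1) * sgn (x $ k) * v $ k) (at 0)" for k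
    by (rule DERIV_chain2[where f = "\<lambda>y. \<bar>y\<bar> powr p" and g = "\<lambda>h. x $ k + h * v $ k"])
       (auto intro!: derivative_eq_intros has_real_derivative_abs_powr[OF assms(1), of "x $ k", simplified])
  then have "(S has_real_derivative (\<Sum>k\<in>UNIV. p * \<bar>x $ k\<bar> powr (p - 1) * sgn (x $ k) * v $ k)) (at 0)"
    unfolding S_def by (intro DERIV_sum) auto
  then have S': "(S has_real_derivative p * D) (at 0)"
    by (simp add: D_def sum_distrib_left mult.assoc)
  have "((\<lambda>h. S h powr (1 / p)) has_real_derivative 1 / p * S 0 powr (1 / p - 1) * (p * D)) (at 0)"
    using DERIV_fun_powr[OF S' S0, of "1 / p"] by simp
  moreover have "(\<lambda>h. S h powr (1 / p)) = (\<lambda>h. lp_norm p (x + h *\<^sub>R v))"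
    by (simp add: S_def lp_norm_def)
  moreover have "1 / p * S 0 powr (1 / p - 1) * (p * D) =
      (\<Sum>k\<in>UNIV. (\<bar>x $ k\<bar> / lp_norm p x) powr (p - 1) * sgn (x $ k) * v $ k)"
  proof -
    have N: "lp_norm p x = S 0 powr (1 / p)"
      by (simp add: S_def lp_norm_def)
    \<comment> \<open>The outer derivative \<open>S 0 powr (1 / p - 1)\<close> is thus the
      reciprocal of \<open>lp_norm p x powr (p - 1)\<close>. Distributed over the sum
      \<open>D\<close>, it yields the normalized quotients, while \<open>p\<close> cancels against
      \<open>1 / p\<close>.\<close>
    have "lp_norm p x powr (p - 1) = S 0 powr (1 - 1 / p)"
      using assms(1) by (simp add: N powr_powr field_simps)
    then have "S 0 powr (1 / p - 1) = 1 / lp_norm p x powr (p - 1)"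
      by (simp add: powr_minus_divide[symmetric])
    moreover have "0 \<le> lp_norm p x"
      by (simp add: lp_norm_def)
    ultimately show ?thesis
      using assms(1) by (simp add: D_def powr_divide sum_divide_distrib)
  qed
  ultimately show ?thesis
    by metis
qed

lemma rel_interior_line_eventually:
  fixes b f g :: "'a :: euclidean_space"
  assumes "b \<in> rel_interior F" and "f \<in> F" and "g \<in> F"
  shows "\<forall>\<^sub>F h in nhds 0. b + h *\<^sub>R (f - g) \<in> F"
proof -
  obtain e where e: "0 < e" "ball b e \<inter> affine hull F \<subseteq> F" and "b \<in> F"
    using assms(1) by (auto simp: mem_rel_interior_ball)
  have "((\<lambda>h. b + h *\<^sub>R (f - g)) \<longlongrightarrow> b + 0 *\<^sub>R (f - g)) (at 0)"
    by (intro tendsto_intros)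
  then have "\<forall>\<^sub>F h in at 0. b + h *\<^sub>R (f - g) \<in> ball b e"
    using e(1) by (intro topological_tendstoD) auto
  \<comment> \<open>An affine combination of \<open>b\<close>, \<open>f\<close>, \<open>g\<close>
    with coefficients \<open>1\<close>, \<open>h\<close>, \<open>-h\<close>.\<close>
  moreover have "b + h *\<^sub>R (f - g) \<in> affine hull F" for h
    using assms(2,3) \<open>b \<in> F\<close> by (intro mem_affine_3_minus affine_affine_hull hull_inc)
  ultimately have "\<forall>\<^sub>F h in at 0. b + h *\<^sub>R (f - g) \<in> F"
    using e(2) by (elim eventually_mono) blast
  then show ?thesis
    using \<open>b \<in> F\<close> by (simp add: eventually_nhds_conv_at)
qed

text \<open>The breaking point \<open>Suc r\<close> ends segment \<open>r\<close> and starts segment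
  \<open>Suc r\<close>. The sum over all other segments does not involve \<open>y\<close>, so it
  cancels when two choices of \<open>y\<close> are compared.\<close>

lemma weighted_length_list_update:
  assumes "Suc r < length \<gamma>" and "length z = Suc (length \<gamma>)"
  shows "weighted_length p \<omega> \<gamma> (z[Suc r := y]) =
      (\<Sum>q\<in>{..<length \<gamma>} - {r, Suc r}. \<omega> (\<gamma> ! q) * lp_norm (p (\<gamma> ! q)) (z ! Suc q - z ! q))
      + (\<omega> (\<gamma> ! r) * lp_norm (p (\<gamma> ! r)) (y - z ! r)
         + \<omega> (\<gamma> ! Suc r) * lp_norm (p (\<gamma> ! Suc r)) (z ! Suc (Suc r) - y))"
proof -
  let ?l = "\<lambda>z q. \<omega> (\<gamma> ! q) * lp_norm (p (\<gamma> ! q)) (z ! Suc q - z ! q)"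
  have "weighted_length p \<omega> \<gamma> (z[Suc r := y]) =
      sum (?l (z[Suc r := y])) ({..<length \<gamma>} - {r, Suc r}) + sum (?l (z[Suc r := y])) {r, Suc r}"
    unfolding weighted_length_def using assms(1) by (intro sum.subset_diff) auto
  moreover have "sum (?l (z[Suc r := y])) ({..<length \<gamma>} - {r, Suc r}) =
      sum (?l z) ({..<length \<gamma>} - {r, Suc r})"
    by (intro sum.cong) (auto simp: nth_list_update)
  ultimately show ?thesis
    using assms by simp
qed

text \<open>Gate points vary independently over their faces, so a minimizing tuple is also minimal
  in each gate point with the others held fixed.\<close>

lemma geodesic_path_gate_minimal:
  assumes "geodesic_path m P p \<omega> s t x\<^sub>s x\<^sub>t \<gamma> z" and "Suc r < length \<gamma>"
    and "y \<in> common_face P (\<gamma> ! r) (\<gamma> ! Suc r)"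
  shows "\<omega> (\<gamma> ! r) * lp_norm (p (\<gamma> ! r)) (z ! Suc r - z ! r)
         + \<omega> (\<gamma> ! Suc r) * lp_norm (p (\<gamma> ! Suc r)) (z ! Suc (Suc r) - z ! Suc r)
       \<le> \<omega> (\<gamma> ! r) * lp_norm (p (\<gamma> ! r)) (y - z ! r)
         + \<omega> (\<gamma> ! Suc r) * lp_norm (p (\<gamma> ! Suc r)) (z ! Suc (Suc r) - y)"
proof -
  obtain ys where ys: "ys \<in> gate_points P \<gamma>" "z = breaking_points x\<^sub>s x\<^sub>t ys"
    and min: "\<And>ys'. ys' \<in> gate_points P \<gamma> \<Longrightarrow> weighted_length p \<omega> \<gamma> (breaking_points x\<^sub>s x\<^sub>t ys)
          \<le> weighted_length p \<omega> \<gamma> (breaking_points x\<^sub>s x\<^sub>t ys')"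
    using assms(1) by (auto simp: geodesic_path_def is_arg_min_linorder)
  have len: "length ys = length \<gamma> - 1"
    using ys(1) by (simp add: gate_points_def)
  \<comment> \<open>The index shifts by one because \<open>x\<^sub>s\<close> stands in front of the
    gate points.\<close>
  then have z: "length z = Suc (length \<gamma>)" "breaking_points x\<^sub>s x\<^sub>t (ys[r := y]) = z[Suc r := y]"
    using assms(2) ys(2) by (auto simp: breaking_points_def list_update_append)
  have "ys[r := y] \<in> gate_points P \<gamma>"
    using ys(1) assms(2,3) len by (simp add: gate_points_def nth_list_update)
  \<comment> \<open>The trivial update on the left lets one formula expand both sides.\<close>
  then have "weighted_length p \<omega> \<gamma> (z[Suc r := z ! Suc r]) \<le> weighted_length p \<omega> \<gamma> (z[Suc r := y])"
    using min[of "ys[r := y]"] z(2) ys(2) by simp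
  then show ?thesis
    unfolding weighted_length_list_update[OF assms(2) z(1)] by simp
qed

theorem proposition2:
  fixes P :: "nat \<Rightarrow> (real ^ 'd) set"
    and p \<omega> :: "nat \<Rightarrow> real"
    and m s t i j r :: nat
    and x\<^sub>s x\<^sub>t a b c :: "real ^ 'd"
    and \<gamma> :: "nat list"
    and z :: "(real ^ 'd) list"
    and F\<^sub>b :: "(real ^ 'd) set"
  assumes "polyhedral_subdivision m P"
    and "\<forall>l\<in>{1..m}. 0 < \<omega> l"
    and "\<forall>l\<in>{1..m}. 1 < p l"
    and "s \<in> {1..m}" and "t \<in> {1..m}" and "s \<noteq> t"
    and "x\<^sub>s \<in> P s" and "x\<^sub>t \<in> P t"
    and "geodesic_path m P p \<omega> s t x\<^sub>s x\<^sub>t \<gamma> z"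
    and "Suc r < length \<gamma>"
    and "i = \<gamma> ! r" and "j = \<gamma> ! Suc r"
    and "a = z ! r" and "b = z ! Suc r" and "c = z ! Suc (Suc r)"
    and "a \<in> P i - common_face P i j"
    and "b \<in> common_face P i j"
    and "c \<in> P j - common_face P i j"
    and "F\<^sub>b face_of common_face P i j"
    and "b \<in> rel_interior F\<^sub>b"
  shows "\<forall>f\<in>F\<^sub>b. \<forall>g\<in>F\<^sub>b.
    \<omega> i * (\<Sum>k\<in>UNIV. (\<bar>b $ k - a $ k\<bar> / lp_norm (p i) (b - a)) powr (p i - 1)
             * sgn (b $ k - a $ k) * (f $ k - g $ k)) =
    \<omega> j * (\<Sum>k\<in>UNIV. (\<bar>c $ k - b $ k\<bar> / lp_norm (p j) (c - b)) powr (p j - 1)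
             * sgn (c $ k - b $ k) * (f $ k - g $ k))"
proof (intro ballI)
  fix f g assume fg: "f \<in> F\<^sub>b" "g \<in> F\<^sub>b"
  let ?v = "f - g"
  let ?I = "\<Sum>k\<in>UNIV. (\<bar>b $ k - a $ k\<bar> / lp_norm (p i) (b - a)) powr (p i - 1)
             * sgn (b $ k - a $ k) * (f $ k - g $ k)"
  let ?J = "\<Sum>k\<in>UNIV. (\<bar>c $ k - b $ k\<bar> / lp_norm (p j) (c - b)) powr (p j - 1)
             * sgn (c $ k - b $ k) * (f $ k - g $ k)"
  \<comment> \<open>The cost of the two segments at the gate once \<open>b\<close> is moved to
    \<open>b + h *\<^sub>R ?v\<close>. The second segment changes in direction \<open>- ?v\<close>,
    whence the opposite sign of \<open>?J\<close> in the derivative.\<close>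
  define \<phi> where "\<phi> = (\<lambda>h. \<omega> i * lp_norm (p i) ((b - a) + h *\<^sub>R ?v)
                            + \<omega> j * lp_norm (p j) ((c - b) + h *\<^sub>R (- ?v)))"
  have "set \<gamma> \<subseteq> {1..m}"
    using assms(9) by (simp add: geodesic_path_def simple_paths_def)
  then have "i \<in> {1..m}" "j \<in> {1..m}"
    using assms(10-12) nth_mem[of r \<gamma>] nth_mem[of "Suc r" \<gamma>] by (auto simp del: nth_mem)
  then have p: "1 < p i" "1 < p j"
    using assms(3) by auto
  \<comment> \<open>Only \<open>b\<close> lies in the common face.\<close>
  have "b - a \<noteq> 0" "c - b \<noteq> 0"
    using assms(16-18) by auto
  note lp_norm_has_real_derivative_line[OF p(1) this(1), of ?v]
    lp_norm_has_real_derivative_line[OF p(2) this(2), of "- ?v"]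
  then have "(\<phi> has_real_derivative \<omega> i * ?I + \<omega> j * (- ?J)) (at 0)"
    unfolding \<phi>_def
    by (intro DERIV_add DERIV_cmult) (simp_all add: sum_negf[symmetric] algebra_simps)
  moreover have "\<forall>\<^sub>F h in nhds 0. \<phi> 0 \<le> \<phi> h"
    using rel_interior_line_eventually[OF assms(20) fg]
  proof (rule eventually_mono)
    fix h assume "b + h *\<^sub>R ?v \<in> F\<^sub>b"
    then have "b + h *\<^sub>R ?v \<in> common_face P (\<gamma> ! r) (\<gamma> ! Suc r)"
      using face_of_imp_subset[OF assms(19)] assms(11,12) by auto
    from geodesic_path_gate_minimal[OF assms(9,10) this] show "\<phi> 0 \<le> \<phi> h"
      by (simp add: \<phi>_def assms(11-15) algebra_simps)
  qed
  then obtain d where "0 < d" "\<forall>h. \<bar>0 - h\<bar> < d \<longrightarrow> \<phi> 0 \<le> \<phi> h"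
    by (auto simp: eventually_nhds_metric dist_real_def)
  ultimately have "\<omega> i * ?I + \<omega> j * (- ?J) = 0"
    by (rule DERIV_local_min)
  then show "\<omega> i * ?I = \<omega> j * ?J"
    by simp
qed

end
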